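(* Let $k\ge 1$, let $X=(X_1,\ldots,X_k)$ be a random vector in $\mathbb{R}^k$ with independent components, let $f$ be a measurable real-valued function, and suppose that $Y=f(X)$ is a continuous random variable. Assume that $\mathbb{E}|Y|<\infty$. Then for all $\alpha\in\,]0,1[$ and all $i=1,\ldots,k$, $$S_{X_i}^{\alpha}=1-\frac{\mathbb{E}\left(Y\,\middle|\,Y>F^{-1}_{Y|X_i}(\alpha)\right)-\mathbb{E}(Y)}{CTE_{\alpha}(Y)-\mathbb{E}(Y)}.$$
   Context: For $\alpha\in\,]0,1[$ the $\alpha$-quantile contrast function is $\psi_\alpha(y,\theta)=(y-\theta)(\alpha-\mathbf{1}_{y\le\theta})$ for $y,\theta\in\mathbb{R}$. The quantile oriented sensitivity index (quantile contrast index) of the input $X_i$ on $Y$ is $$S_{X_i}^\alpha=\frac{\min_{\theta\in\mathbb{R}}\mathbb{E}[\psi_\alpha(Y;\theta)]-\mathbb{E}\left(\min_{\theta\in\mathbb{R}}\mathbb{E}[\psi_\alpha(Y;\theta)\mid X_i]\right)}{\min_{\theta\in\mathbb{R}}\mathbb{E}[\psi_\alpha(Y;\theta)]}.$$ For a random variable $Z$, $F_Z$ denotes its distribution function and $F_Z^{-1}$ the generalized inverse of $F_Z$ (quantile function). For a continuous random variable $Z$ with finite first moment, the Conditional Tail Expectation at level $\alpha\in\,]0,1[$ is $$CTE_\alpha(Z)=\mathbb{E}\left[Z\mid Z>F_Z^{-1}(\alpha)\right]=\frac{1}{1-\alpha}\int_\alpha^1F_Z^{-1}(u)\,du.$$ The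 conditional distribution function of $Y$ given $X_i$ is $F_{Y|X_i}(y)=\mathbb{P}(Y\le y\mid X_i)$, $y\in\mathbb{R}$, and the conditional quantile is $F_{Y|X_i}^{-1}(\alpha)=\inf\{y\in\mathbb{R}: F_{Y|X_i}(y)\ge\alpha\}$; both are $X_i$-measurable random quantities. In $\mathbb{E}(Y\mid Y>F^{-1}_{Y|X_i}(\alpha))$ the conditioning is on the event $\{Y>F^{-1}_{Y|X_i}(\alpha)\}$.
   Formalization: The formal theorem additionally assumes that, almost surely, the conditional law of Y given X_i has a continuous distribution function; without this the formula fails, e.g. for Y = X_1 + X_2 with X_1 uniform on [0,1], X_2 Bernoulli(1/2), i = 1, α = 1/4. *)

theory Defs
  imports "HOL-Probability.Probability"
begin

definition quantile_contrast :: "real \<Rightarrow> real \<Rightarrow> real \<Rightarrow> real" where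
  "quantile_contrast \<alpha> y \<theta> = (y - \<theta>) * (\<alpha> - (if y \<le> \<theta> then 1 else 0))"

definition quantile :: "real measure \<Rightarrow> real \<Rightarrow> real" where
  "quantile N \<alpha> = Inf {y. \<alpha> \<le> cdf N y}"

text \<open>
  The distribution function is continuous; no density is required.  Besides the law of \<open>Y\<close> this is
  also required of the conditional law of \<open>Y\<close> given the input \<open>X\<close> under consideration.  Continuity
  of the law of \<open>Y\<close> alone does not give \<open>P(Y > F\<inverse>\<^bsub>Y|X\<^esub>(\<alpha>)) = 1 - \<alpha>\<close>: for \<open>Y = X\<close> that event is
  empty, and conditioning on it is meaningless.
\<close>

definition continuous_law :: "real measure \<Rightarrow> bool" where
  "continuous_law N \<longleftrightarrow> continuous_on UNIV (cdf N)"

text \<open>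
  A minimum over all real arguments in the literal sense: \<open>LEAST\<close> on the reals only denotes a
  meaningful value if the minimum is attained.
\<close>

definition min_value :: "(real \<Rightarrow> real) \<Rightarrow> real" where
  "min_value g = (LEAST m. m \<in> range g)"

text \<open>
  Elementary conditional expectation given an event.  It is \<open>0\<close> if the event has probability \<open>0\<close>.
\<close>

definition expectation_given_event :: "'a measure \<Rightarrow> ('a \<Rightarrow> real) \<Rightarrow> 'a set \<Rightarrow> real" where
  "expectation_given_event M Z A = (LINT \<omega>:A|M. Z \<omega>) / measure M A"

definition CTE :: "'a measure \<Rightarrow> ('a \<Rightarrow> real) \<Rightarrow> real \<Rightarrow> real" where
  "CTE M Z \<alpha> = expectation_given_event M Z {\<omega> \<in> space M. quantile (distr M borel Z) \<alpha> < Z \<omega>}"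

text \<open>
  Minimising \<open>E[\<psi>(Y; \<theta>) | X]\<close> over all real \<open>\<theta>\<close>, or inverting \<open>y \<mapsto> P(Y \<le> y | X)\<close>, is meaningless
  for almost-everywhere classes chosen separately for each of the uncountably many parameters.
  All quantities conditional on \<open>X\<close> are therefore computed from one regular conditional
  distribution \<open>\<kappa>\<close>, i.e. a probability kernel with \<open>P(Y \<in> B | X) = \<kappa> X B\<close> almost surely for all
  Borel sets \<open>B\<close>.  Two such kernels agree at \<open>X \<omega>\<close> for almost all \<open>\<omega>\<close>, so the choice of version
  made below is immaterial.
\<close>

definition is_regular_cond_law ::
    "'a measure \<Rightarrow> ('a \<Rightarrow> real) \<Rightarrow> ('a \<Rightarrow> real) \<Rightarrow> (real \<Rightarrow> real measure) \<Rightarrow> bool" where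
  "is_regular_cond_law M X Y \<kappa> \<longleftrightarrow>
     \<kappa> \<in> borel \<rightarrow>\<^sub>M prob_algebra borel \<and>
     (\<forall>B\<in>sets borel. AE \<omega> in M.
        real_cond_exp M (vimage_algebra (space M) X borel) (\<lambda>\<omega>. indicator B (Y \<omega>)) \<omega>
          = measure (\<kappa> (X \<omega>)) B)"

definition cond_law :: "'a measure \<Rightarrow> ('a \<Rightarrow> real) \<Rightarrow> ('a \<Rightarrow> real) \<Rightarrow> real \<Rightarrow> real measure" where
  "cond_law M X Y = (SOME \<kappa>. is_regular_cond_law M X Y \<kappa>)"

definition cond_quantile :: "'a measure \<Rightarrow> ('a \<Rightarrow> real) \<Rightarrow> ('a \<Rightarrow> real) \<Rightarrow> real \<Rightarrow> 'a \<Rightarrow> real" where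
  "cond_quantile M X Y \<alpha> \<omega> = quantile (cond_law M X Y (X \<omega>)) \<alpha>"

definition quantile_index :: "'a measure \<Rightarrow> ('a \<Rightarrow> real) \<Rightarrow> ('a \<Rightarrow> real) \<Rightarrow> real \<Rightarrow> real" where
  "quantile_index M X Y \<alpha> =
     (min_value (\<lambda>\<theta>. LINT \<omega>|M. quantile_contrast \<alpha> (Y \<omega>) \<theta>)
        - (LINT \<omega>|M. min_value (\<lambda>\<theta>. LINT y|cond_law M X Y (X \<omega>). quantile_contrast \<alpha> y \<theta>)))
      / min_value (\<lambda>\<theta>. LINT \<omega>|M. quantile_contrast \<alpha> (Y \<omega>) \<theta>)"

lemma borel_measurable_vec_lambda:
  fixes g :: "'k::finite \<Rightarrow> 'b \<Rightarrow> real"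
  assumes "\<And>j. g j \<in> borel_measurable N"
  shows "(\<lambda>w. \<chi> j. g j w) \<in> borel_measurable N"
  unfolding borel_measurable_euclidean_space[where f = "\<lambda>w. \<chi> j. g j w"]
  using assms by (auto simp: Basis_vec_def inner_axis)

text \<open>
  For a function of independent inputs a regular conditional distribution given one input exists:
  freeze that input and average over the others.  Hence \<^const>\<open>cond_law\<close> is well-defined there.
\<close>

lemma is_regular_cond_law_freeze:
  fixes M :: "'a measure" and X :: "'a \<Rightarrow> real ^ 'k" and f :: "real ^ 'k \<Rightarrow> real"
  assumes P: "prob_space M"
    and ind: "prob_space.indep_vars M (\<lambda>_. borel) (\<lambda>j \<omega>. X \<omega> $ j) UNIV"
    and f [measurable]: "f \<in> borel_measurable borel"
  shows "is_regular_cond_law M (\<lambda>\<omega>. X \<omega> $ i) (\<lambda>\<omega>. f (X \<omega>))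
           (\<lambda>x. distr M borel (\<lambda>\<omega>. f (\<chi> j. if j = i then x else X \<omega> $ j)))"
    (is "is_regular_cond_law M ?X ?Y ?K")
proof -
  interpret prob_space M by (rule P)
  have Xm [measurable]: "(\<lambda>\<omega>. X \<omega> $ j) \<in> borel_measurable M" for j
    using ind by (auto simp: indep_vars_def)
  have Xv: "X \<in> borel_measurable M"
    using borel_measurable_vec_lambda[of "\<lambda>j \<omega>. X \<omega> $ j" M] Xm by simp
  have Y [measurable]: "?Y \<in> borel_measurable M" using Xv f by measurable
  define Z where "Z \<omega> = (\<chi> j. if j = i then 0 else X \<omega> $ j)" for \<omega>
  define h where "h x z = f (\<chi> j. if j = i then x else z $ j)" for x and z :: "real ^ 'k"
  define U where "U \<omega> = (\<chi> j. if j = i then X \<omega> $ j else 0)" for \<omega>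
  have U [measurable]: "U \<in> borel_measurable M"
    unfolding U_def by (rule borel_measurable_vec_lambda) auto
  have Ui: "U \<omega> $ i = X \<omega> $ i" for \<omega> by (simp add: U_def)
  have Z [measurable]: "Z \<in> borel_measurable M"
    unfolding Z_def by (rule borel_measurable_vec_lambda) auto
  have nth [measurable]: "(\<lambda>z :: real ^ 'k. z $ j) \<in> borel_measurable borel" for j
    by (intro borel_measurable_continuous_onI continuous_intros)
  have "(\<lambda>p :: real \<times> (real ^ 'k). \<chi> j. if j = i then fst p else snd p $ j) \<in> borel_measurable (borel \<Otimes>\<^sub>M borel)"
    by (rule borel_measurable_vec_lambda) auto
  then have h [measurable]: "case_prod h \<in> borel_measurable (borel \<Otimes>\<^sub>M borel)"
    unfolding h_def case_prod_beta by measurable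
  have K: "?K x = distr M borel (\<lambda>\<omega>. h x (Z \<omega>))" for x
    unfolding h_def Z_def by (intro arg_cong[where f = "distr M borel"] ext arg_cong[where f = f])
      (auto simp: vec_eq_iff)
  have YZ: "?Y \<omega> = h (?X \<omega>) (Z \<omega>)" for \<omega>
    unfolding h_def Z_def by (intro arg_cong[where f = f]) (auto simp: vec_eq_iff)
  have "?K \<in> borel \<rightarrow>\<^sub>M prob_algebra borel"
    unfolding K
  proof (rule measurable_distr_prob_space2)
    show "(\<lambda>_. M) \<in> borel \<rightarrow>\<^sub>M prob_algebra M"
      by (intro measurable_const) (simp add: space_prob_algebra P)
  qed measurable
  moreover have "AE \<omega> in M. real_cond_exp M (vimage_algebra (space M) ?X borel) (\<lambda>\<omega>. indicator B (?Y \<omega>)) \<omega>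
          = measure (?K (?X \<omega>)) B" if B [measurable]: "B \<in> sets borel" for B
  proof -
    let ?F = "vimage_algebra (space M) ?X borel"
    have sub: "subalgebra M ?F"
      by (auto simp: subalgebra_def sets_vimage_algebra2)
    interpret F: finite_measure_subalgebra M ?F
      by (rule finite_measure_subalgebra.intro[OF finite_measure_axioms])
         (simp add: finite_measure_subalgebra_axioms.intro sub)
    have Kp: "prob_space (?K x)" for x
      unfolding K by (rule prob_space_distr) measurable
    have mB [measurable]: "(\<lambda>x. measure (?K x) B) \<in> borel_measurable borel"
      using measurable_compose[OF \<open>?K \<in> borel \<rightarrow>\<^sub>M prob_algebra borel\<close> measurable_measure_prob_algebra[OF B]] .
    have mX: "?X \<in> measurable ?F borel"
      by (rule measurable_vimage_algebra1) auto
    have intK: "integrable M (\<lambda>\<omega>. measure (?K (?X \<omega>)) B)"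
      by (rule integrable_const_bound[where B = 1]) (auto simp: prob_space.prob_le_1[OF Kp])
    have intY: "integrable M (\<lambda>\<omega>. indicator B (?Y \<omega>) :: real)"
      by (rule integrable_const_bound[where B = 1]) (auto simp: indicator_def)
    have "indep_var (PiM {i} (\<lambda>_. borel)) (\<lambda>\<omega>. \<lambda>j\<in>{i}. X \<omega> $ j)
       (PiM (UNIV - {i}) (\<lambda>_. borel)) (\<lambda>\<omega>. \<lambda>j\<in>UNIV - {i}. X \<omega> $ j)"
      using indep_var_restrict[OF ind, of "{i}" "UNIV - {i}"] by auto
    then have "indep_var borel ((\<lambda>g. \<chi> j. if j = i then g j else 0) \<circ> (\<lambda>\<omega>. \<lambda>j\<in>{i}. X \<omega> $ j))
       borel ((\<lambda>g. \<chi> j. if j = i then 0 else g j) \<circ> (\<lambda>\<omega>. \<lambda>j\<in>UNIV - {i}. X \<omega> $ j))"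
    proof (rule indep_var_compose)
      show "(\<lambda>g :: 'k \<Rightarrow> real. \<chi> j. if j = i then 0 else g j) \<in> borel_measurable (PiM (UNIV - {i}) (\<lambda>_. borel))"
      proof (rule borel_measurable_vec_lambda)
        show "(\<lambda>g :: 'k \<Rightarrow> real. if j = i then 0 else g j) \<in> borel_measurable (PiM (UNIV - {i}) (\<lambda>_. borel))" for j
          by (cases "j = i") (auto intro!: measurable_component_singleton)
      qed
      show "(\<lambda>g :: 'k \<Rightarrow> real. \<chi> j. if j = i then g j else 0) \<in> borel_measurable (PiM {i} (\<lambda>_. borel))"
      proof (rule borel_measurable_vec_lambda)
        show "(\<lambda>g :: 'k \<Rightarrow> real. if j = i then g j else 0) \<in> borel_measurable (PiM ({i}) (\<lambda>_. borel))" for j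
          by (cases "j = i") (auto intro!: measurable_component_singleton)
      qed
    qed
    moreover have "(\<lambda>g. \<chi> j. if j = i then g j else 0) \<circ> (\<lambda>\<omega>. \<lambda>j\<in>{i}. X \<omega> $ j) = U"
      by (auto simp: U_def vec_eq_iff)
    moreover have "(\<lambda>g. \<chi> j. if j = i then 0 else g j) \<circ> (\<lambda>\<omega>. \<lambda>j\<in>UNIV - {i}. X \<omega> $ j) = Z"
      by (auto simp: Z_def vec_eq_iff)
    ultimately have "indep_var borel U borel Z" by simp
    then have prod: "distr M (borel \<Otimes>\<^sub>M borel) (\<lambda>\<omega>. (U \<omega>, Z \<omega>)) = distr M borel U \<Otimes>\<^sub>M distr M borel Z"
      by (simp add: indep_var_distribution_eq)
    interpret DX: prob_space "distr M borel U" by (rule prob_space_distr) measurable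
    interpret DZ: prob_space "distr M borel Z" by (rule prob_space_distr) measurable
    interpret DXZ: pair_prob_space "distr M borel U" "distr M borel Z" ..
    have KB: "measure (?K x) B = (LINT z|distr M borel Z. indicator B (h x z))" for x
    proof -
      have hx [measurable]: "h x \<in> borel_measurable borel" by measurable
      have "(LINT z|distr M borel Z. indicator B (h x z)) = (LINT \<omega>|M. indicator B (h x (Z \<omega>)) :: real)"
        by (rule integral_distr) measurable
      also have "\<dots> = (LINT y|?K x. indicator B y)"
        unfolding K by (rule integral_distr[symmetric]) measurable
      also have "\<dots> = measure (?K x) B" by (simp add: K)
      finally show ?thesis by simp
    qed
    show ?thesis
    proof (rule F.real_cond_exp_charact[OF _ intY intK])
      show "(\<lambda>\<omega>. measure (?K (?X \<omega>)) B) \<in> borel_measurable ?F"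
        using measurable_compose[OF mX mB] .
      fix A assume "A \<in> sets ?F"
      then obtain A' where A' [measurable]: "A' \<in> sets borel" and A: "A = ?X -` A' \<inter> space M"
        by (auto simp: sets_vimage_algebra2)
      have hh: "(\<lambda>p :: (real ^ 'k) \<times> (real ^ 'k). indicator A' (fst p $ i) * indicator B (h (fst p $ i) (snd p)) :: real) \<in> borel_measurable (borel \<Otimes>\<^sub>M borel)"
        by measurable
      have "(LINT \<omega>:A|M. indicator B (?Y \<omega>))
          = (LINT \<omega>|M. (\<lambda>p :: (real ^ 'k) \<times> (real ^ 'k). indicator A' (fst p $ i) * indicator B (h (fst p $ i) (snd p)) :: real) (U \<omega>, Z \<omega>))"
        unfolding set_lebesgue_integral_def A YZ
        by (rule Bochner_Integration.integral_cong) (auto simp: indicator_def Ui)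
      also have "\<dots> = (LINT p|(distr M borel U \<Otimes>\<^sub>M distr M borel Z). indicator A' (fst p $ i) * indicator B (h (fst p $ i) (snd p)))"
        unfolding prod[symmetric] by (rule integral_distr[symmetric]) (use hh in measurable)
      also have "\<dots> = (LINT u|distr M borel U. LINT z|distr M borel Z. indicator A' (u $ i) * indicator B (h (u $ i) z))"
      proof -
        have m: "(\<lambda>p :: (real ^ 'k) \<times> (real ^ 'k). indicator A' (fst p $ i) * indicator B (h (fst p $ i) (snd p)) :: real)
               \<in> borel_measurable (distr M borel U \<Otimes>\<^sub>M distr M borel Z)"
          using hh by (simp cong: measurable_cong_sets)
        have "integrable (distr M borel U \<Otimes>\<^sub>M distr M borel Z)
               (\<lambda>p :: (real ^ 'k) \<times> (real ^ 'k). indicator A' (fst p $ i) * indicator B (h (fst p $ i) (snd p)) :: real)"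
          by (rule DXZ.P.integrable_const_bound[where B = 1, OF _ m]) (auto simp: indicator_def)
        from DXZ.integral_fst'[OF this] show ?thesis by simp
      qed
      also have "\<dots> = (LINT u|distr M borel U. indicator A' (u $ i) * measure (?K (u $ i)) B)"
        by (simp add: KB)
      also have "\<dots> = (LINT \<omega>|M. indicator A' (?X \<omega>) * measure (?K (?X \<omega>)) B)"
        unfolding Ui[symmetric] by (rule integral_distr) (use mB in measurable)
      also have "\<dots> = (LINT \<omega>:A|M. measure (?K (?X \<omega>)) B)"
        unfolding set_lebesgue_integral_def A
        by (rule Bochner_Integration.integral_cong) (auto simp: indicator_def)
      finally show "(LINT \<omega>:A|M. indicator B (?Y \<omega>)) = (LINT \<omega>:A|M. measure (?K (?X \<omega>)) B)" .
    qed
  qed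
  ultimately show ?thesis
    unfolding is_regular_cond_law_def by blast
qed

end

theory Submission
  imports Defs
begin

text \<open>
  At a continuous law with finite mean the contrast is minimal at the quantile \<open>q\<close>, where its value
  is \<open>E[Y; Y > q] - (1 - \<alpha>) E[Y]\<close>.  Applied to the law of \<open>Y\<close> this is \<open>(1 - \<alpha>) (CTE - E[Y])\<close>.
  Applied to the conditional laws and averaged by disintegration it is
  \<open>(1 - \<alpha>) (E[Y | Y > Q] - E[Y])\<close>, with \<open>Q\<close> the conditional quantile, because \<open>P(Y > Q) = 1 - \<alpha>\<close>.
\<close>

section \<open>Pointwise properties of the contrast function\<close>

text \<open>Separates the summand linear in \<open>y\<close> from the one with factor \<theta>. When
  \<theta> is the quantile of a continuous law, the second has mean zero, which leaves a tail
  integral.\<close>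

lemma contrast_split:
  "quantile_contrast \<alpha> y \<theta> = y * (indicator {\<theta><..} y - (1 - \<alpha>)) + \<theta> * (indicator {..\<theta>} y - \<alpha>)"
  by (auto simp: quantile_contrast_def indicator_def algebra_simps)

text \<open>The contrast is the absolute value with slopes \<alpha> and 1 - \<alpha> on its two
  sides. The bound by the smaller slope yields both integrability of \<open>y\<close> and strict
  positivity off \<open>y\<close> = \<theta>.\<close>

lemma contrast_ge_abs:
  assumes "0 < \<alpha>" "\<alpha> < 1"
  shows "min \<alpha> (1 - \<alpha>) * \<bar>y - \<theta>\<bar> \<le> quantile_contrast \<alpha> y \<theta>"
proof (cases "y \<le> \<theta>")
  case True
  have "min \<alpha> (1 - \<alpha>) * \<bar>y - \<theta>\<bar> \<le> (1 - \<alpha>) * \<bar>y - \<theta>\<bar>" by (rule mult_right_mono) auto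
  with True show ?thesis by (simp add: quantile_contrast_def algebra_simps)
next
  case False
  have "min \<alpha> (1 - \<alpha>) * \<bar>y - \<theta>\<bar> \<le> \<alpha> * \<bar>y - \<theta>\<bar>" by (rule mult_right_mono) auto
  with False show ?thesis by (simp add: quantile_contrast_def algebra_simps)
qed

text \<open>The contrast is convex in \<theta>, and \<open>indicator {..q} y - \<alpha>\<close> is
  its right derivative at \<open>q\<close>. The left derivative in the next lemma differs only at
  \<open>y = q\<close>; keeping both covers laws with atoms.\<close>

lemma contrast_subgradient_right:
  "q \<le> \<theta> \<Longrightarrow> quantile_contrast \<alpha> y q + (\<theta> - q) * (indicator {..q} y - \<alpha>) \<le> quantile_contrast \<alpha> y \<theta>"
  by (auto simp: quantile_contrast_def indicator_def algebra_simps)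

lemma contrast_subgradient_left:
  "\<theta> \<le> q \<Longrightarrow> quantile_contrast \<alpha> y q + (\<theta> - q) * (indicator {..<q} y - \<alpha>) \<le> quantile_contrast \<alpha> y \<theta>"
  by (cases "y = q") (auto simp: quantile_contrast_def indicator_def algebra_simps)

lemma borel_measurable_contrast [measurable]:
  assumes [measurable]: "f \<in> borel_measurable N" "g \<in> borel_measurable N"
  shows "(\<lambda>x. quantile_contrast \<alpha> (f x) (g x)) \<in> borel_measurable N"
  unfolding quantile_contrast_def by measurable

lemma min_value_eq:
  assumes "\<And>x. g q \<le> g x"
  shows "min_value g = g q"
  unfolding min_value_def by (rule Least_equality) (use assms in auto)

section \<open>Quantiles and minimal contrast of a single law\<close>

context real_distribution
begin

text \<open>Right continuity of the distribution function makes the infimum attained, which turns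
  the quantile into a Galois adjoint of \<open>cdf M\<close>. Atoms are allowed here.\<close>

lemma cdf_quantile:
  assumes "0 < \<alpha>" "\<alpha> < 1"
  shows quantile_le_iff: "quantile M \<alpha> \<le> t \<longleftrightarrow> \<alpha> \<le> cdf M t"
    and prob_less_quantile: "prob {..<quantile M \<alpha>} \<le> \<alpha>"
proof -
  let ?A = "{y. \<alpha> \<le> cdf M y}" and ?q = "quantile M \<alpha>"
  \<comment> \<open>The limits 1 at the top and 0 at the bottom make \<open>?A\<close> nonempty and
    bounded below, so \<open>Inf\<close> is a genuine infimum.\<close>
  have "eventually (\<lambda>y. \<alpha> < cdf M y) at_top"
    using order_tendstoD(1)[OF cdf_lim_at_top_prob] assms by auto
  then have ne: "?A \<noteq> {}"
    by (auto simp: eventually_at_top_linorder intro: less_imp_le)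
  have "eventually (\<lambda>y. cdf M y < \<alpha>) at_bot"
    using order_tendstoD(2)[OF cdf_lim_at_bot] assms by auto
  then obtain b where b: "\<And>y. y \<le> b \<Longrightarrow> cdf M y < \<alpha>"
    by (auto simp: eventually_at_bot_linorder)
  have bdd: "bdd_below ?A"
    by (rule bdd_belowI[of _ b]) (use b in \<open>metis mem_Collect_eq linorder_not_le less_imp_le\<close>)
  have gt: "\<alpha> \<le> cdf M y" if "?q < y" for y
  proof -
    from that obtain z where "z \<in> ?A" "z < y"
      unfolding quantile_def using cInf_less_iff[OF ne bdd] by auto
    then show ?thesis using cdf_nondecreasing[of z y] by auto
  qed
  \<comment> \<open>The level \<alpha> is reached at every point to the right of the infimum; right
    continuity carries this to the infimum itself.\<close>
  have "(cdf M \<longlongrightarrow> cdf M ?q) (at_right ?q)"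
    using cdf_is_right_cont by (simp add: continuous_within)
  moreover have "eventually (\<lambda>y. \<alpha> \<le> cdf M y) (at_right ?q)"
    using gt by (auto simp: eventually_at_filter)
  ultimately have q: "\<alpha> \<le> cdf M ?q"
    by (intro tendsto_lowerbound) auto
  show "?q \<le> t \<longleftrightarrow> \<alpha> \<le> cdf M t"
    using q cdf_nondecreasing[of ?q t] cInf_lower[OF _ bdd, of t] by (auto simp: quantile_def)
  then have "cdf M t \<le> \<alpha>" if "t < ?q" for t
    using cInf_lower[OF _ bdd, of t] that by (force simp: quantile_def)
  \<comment> \<open>The left limit of \<open>cdf M\<close> at \<open>?q\<close> is the mass of the
    open half-line, so the bound below \<open>?q\<close> passes to the limit.\<close>
  then have "eventually (\<lambda>y. cdf M y \<le> \<alpha>) (at_left ?q)"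
    by (auto simp: eventually_at_filter)
  with cdf_at_left show "prob {..<?q} \<le> \<alpha>"
    by (intro tendsto_upperbound[of "cdf M"]) auto
qed

text \<open>A continuous law has no atom at the quantile, so the open and the closed half-line have
  equal mass, squeezed to \<alpha> by the two bounds of \<open>cdf_quantile\<close>.\<close>

lemma prob_le_quantile:
  assumes "0 < \<alpha>" "\<alpha> < 1" "continuous_law M"
  shows "prob {..quantile M \<alpha>} = \<alpha>"
proof -
  let ?q = "quantile M \<alpha>"
  have "isCont (cdf M) ?q"
    using assms(3) by (simp add: continuous_law_def continuous_on_eq_continuous_at)
  then have "prob {?q} = 0" by (simp add: isCont_cdf)
  moreover have "prob {..?q} = prob {..<?q} + prob {?q}"
    unfolding ivl_disj_un(2)[symmetric] by (subst finite_measure_Union) auto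
  ultimately show ?thesis
    using quantile_le_iff[OF assms(1,2), of ?q] prob_less_quantile[OF assms(1,2)]
    by (simp add: cdf_def)
qed

lemma prob_gt_quantile:
  assumes "0 < \<alpha>" "\<alpha> < 1" "continuous_law M"
  shows "prob {quantile M \<alpha><..} = 1 - \<alpha>"
proof -
  have "{quantile M \<alpha><..} = space M - {..quantile M \<alpha>}" by auto
  then show ?thesis using prob_compl[of "{..quantile M \<alpha>}"] prob_le_quantile[OF assms] by simp
qed

lemma integrable_indicator: "B \<in> sets borel \<Longrightarrow> integrable M (indicator B :: real \<Rightarrow> real)"
  by (intro integrable_real_indicator) (auto simp: emeasure_eq_measure)

text \<open>The contrast dominates a positive multiple of the distance to \<theta>, and conversely
  it is a bounded multiple of \<open>y\<close> plus a bounded term. Hence integrability does not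
  depend on \<theta>.\<close>

lemma integrable_contrast_iff:
  assumes "0 < \<alpha>" "\<alpha> < 1"
  shows "integrable M (\<lambda>y. quantile_contrast \<alpha> y \<theta>) \<longleftrightarrow> integrable M (\<lambda>y. y)"
proof
  assume *: "integrable M (\<lambda>y. quantile_contrast \<alpha> y \<theta>)"
  have "integrable M (\<lambda>y. min \<alpha> (1 - \<alpha>) * (y - \<theta>))"
    by (rule Bochner_Integration.integrable_bound[OF *])
      (use contrast_ge_abs[OF assms] assms in
       \<open>auto simp: abs_mult intro!: AE_I2 order_trans[OF _ abs_ge_self]\<close>)
  then have "integrable M (\<lambda>y. (y - \<theta>) + \<theta>)"
    using assms by (intro Bochner_Integration.integrable_add) auto
  then show "integrable M (\<lambda>y. y)" by simp
next
  assume *: "integrable M (\<lambda>y. y)"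
  have "integrable M (\<lambda>y. (indicator {\<theta><..} y - (1 - \<alpha>)) *\<^sub>R y)"
    by (rule Bochner_Integration.integrable_bound[OF *])
      (use assms in \<open>auto simp: abs_mult indicator_def intro!: mult_left_le_one_le\<close>)
  then show "integrable M (\<lambda>y. quantile_contrast \<alpha> y \<theta>)"
    unfolding contrast_split
    by (intro Bochner_Integration.integrable_add integrable_mult_right Bochner_Integration.integrable_diff)
       (auto simp: mult.commute intro!: integrable_indicator)
qed

text \<open>
  Integrability is not assumed: without it all the integrals are \<open>0\<close> and the equation still holds.
  Hence the minimum is a measurable function of the conditioning variable at every point, not
  only almost everywhere.
\<close>

lemma min_value_contrast:
  assumes \<alpha>: "0 < \<alpha>" "\<alpha> < 1"
  shows "min_value (\<lambda>\<theta>. LINT y|M. quantile_contrast \<alpha> y \<theta>) = (LINT y|M. quantile_contrast \<alpha> y (quantile M \<alpha>))"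
proof (rule min_value_eq)
  fix \<theta>
  let ?q = "quantile M \<alpha>"
  show "(LINT y|M. quantile_contrast \<alpha> y ?q) \<le> (LINT y|M. quantile_contrast \<alpha> y \<theta>)"
  proof (cases "integrable M (\<lambda>y. y)")
    case False
    then show ?thesis
      using integrable_contrast_iff[OF \<alpha>] by (simp add: not_integrable_integral_eq)
  next
    case True
    note int [simp] = integrable_contrast_iff[OF \<alpha>, THEN iffD2, OF True]
    \<comment> \<open>Integrating a pointwise subgradient bounds the expected contrast below by a
      line through its value at the quantile, of slope \<open>prob B - \<alpha>\<close>. The closed
      half-line gives a slope at least 0 for larger \<theta>, the open one a slope at most 0 for
      smaller \<theta>.\<close>
    have tangent: "(LINT y|M. quantile_contrast \<alpha> y ?q) \<le> (LINT y|M. quantile_contrast \<alpha> y \<theta>)"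
      if B: "B \<in> sets borel" and slope: "0 \<le> (\<theta> - ?q) * (prob B - \<alpha>)"
        and le: "\<And>y. quantile_contrast \<alpha> y ?q + (\<theta> - ?q) * (indicator B y - \<alpha>) \<le> quantile_contrast \<alpha> y \<theta>" for B
    proof -
      note [simp] = integrable_indicator[OF B]
      have "(LINT y|M. quantile_contrast \<alpha> y ?q) + (\<theta> - ?q) * (prob B - \<alpha>)
          = (LINT y|M. quantile_contrast \<alpha> y ?q + (\<theta> - ?q) * (indicator B y - \<alpha>))"
        using B prob_space by simp
      also have "\<dots> \<le> (LINT y|M. quantile_contrast \<alpha> y \<theta>)"
        by (rule integral_mono) (use le in auto)
      finally show ?thesis using slope by simp
    qed
    show ?thesis
    proof (cases "?q \<le> \<theta>")
      case True
      with quantile_le_iff[OF \<alpha>, of ?q] show ?thesis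
        by (intro tangent[of "{..?q}"] contrast_subgradient_right) (auto simp: cdf_def)
    next
      case False
      with prob_less_quantile[OF \<alpha>] show ?thesis
        by (intro tangent[of "{..<?q}"] contrast_subgradient_left) (auto intro!: mult_nonpos_nonpos)
    qed
  qed
qed

text \<open>By \<open>contrast_split\<close>, only the summand with factor \<theta> has to vanish in
  mean, and it does because the closed half-line up to the quantile has mass exactly
  \<alpha>.\<close>

lemma integral_contrast_quantile:
  assumes \<alpha>: "0 < \<alpha>" "\<alpha> < 1" and "continuous_law M" and int: "integrable M (\<lambda>y. y)"
  shows "(LINT y|M. quantile_contrast \<alpha> y (quantile M \<alpha>))
    = (LINT y|M. y * (indicator {quantile M \<alpha><..} y - (1 - \<alpha>)))"
proof -
  let ?q = "quantile M \<alpha>"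
  note [simp] = integrable_indicator[of "{..?q}"]
  have tail: "(LINT y|M. ?q * (indicator {..?q} y - \<alpha>)) = 0"
    using prob_le_quantile[OF assms(1-3)] prob_space[unfolded space_eq_univ] by simp
  \<comment> \<open>The first summand is the contrast minus a bounded term, so it inherits
    integrability and the integral may be split.\<close>
  have "integrable M (\<lambda>y. quantile_contrast \<alpha> y ?q - ?q * (indicator {..?q} y - \<alpha>))"
    using integrable_contrast_iff[OF \<alpha>] int by simp
  then have "integrable M (\<lambda>y. y * (indicator {?q<..} y - (1 - \<alpha>)))"
    by (simp add: contrast_split)
  then show ?thesis
    unfolding contrast_split by (subst Bochner_Integration.integral_add) (simp_all only: tail, simp_all)
qed

text \<open>The contrast vanishes only at \<open>y\<close> = \<theta>, a null set for a continuous
  law. This keeps the denominator of the index away from 0.\<close>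

lemma integral_contrast_pos:
  assumes \<alpha>: "0 < \<alpha>" "\<alpha> < 1" and "continuous_law M" and int: "integrable M (\<lambda>y. y)"
  shows "0 < (LINT y|M. quantile_contrast \<alpha> y \<theta>)"
proof -
  have "isCont (cdf M) \<theta>"
    using assms(3) by (simp add: continuous_law_def continuous_on_eq_continuous_at)
  then have "prob {\<theta>} = 0" by (simp add: isCont_cdf)
  then have "AE y in M. y \<noteq> \<theta>"
    by (intro AE_I[of _ _ "{\<theta>}"]) (auto simp: emeasure_eq_measure)
  then have "AE y in M. 0 < quantile_contrast \<alpha> y \<theta>"
  proof eventually_elim
    case (elim y)
    then have "0 < min \<alpha> (1 - \<alpha>) * \<bar>y - \<theta>\<bar>" using \<alpha> by simp
    then show ?case using contrast_ge_abs[OF \<alpha>, of y \<theta>] by linarith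
  qed
  then show ?thesis
    using integrable_contrast_iff[OF \<alpha>] int
    by (intro integral_less_AE_space[of "\<lambda>_. 0", simplified]) (auto simp: emeasure_space_1[unfolded space_eq_univ])
qed

end

section \<open>Disintegration along a regular conditional law\<close>

lemma is_regular_cond_law_cond_law:
  assumes "is_regular_cond_law M X Y \<kappa>"
  shows "is_regular_cond_law M X Y (cond_law M X Y)"
  unfolding cond_law_def using someI[of "is_regular_cond_law M X Y", OF assms] .

text \<open>The kernel is kept arbitrary, so the results hold for every version of the conditional
  law and not just for the one chosen by \<open>cond_law\<close>.\<close>

locale cond_law_kernel = prob_space M for M :: "'a measure" +
  fixes X Y :: "'a \<Rightarrow> real" and \<kappa> :: "real \<Rightarrow> real measure"
  assumes X [measurable]: "X \<in> borel_measurable M" and Y [measurable]: "Y \<in> borel_measurable M"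
    and regular: "is_regular_cond_law M X Y \<kappa>"
begin

lemma kernel_prob [measurable]: "\<kappa> \<in> borel \<rightarrow>\<^sub>M prob_algebra borel"
  using regular by (simp add: is_regular_cond_law_def)

lemma kernel_subprob [measurable]: "\<kappa> \<in> borel \<rightarrow>\<^sub>M subprob_algebra borel"
  using kernel_prob by (rule measurable_prob_algebraD)

lemma real_distribution_kernel: "real_distribution (\<kappa> x)"
  using measurable_space[OF kernel_prob, of x]
  by (auto simp: space_prob_algebra real_distribution_def real_distribution_axioms_def)

lemma sets_kernel [simp, measurable_cong]: "sets (\<kappa> x) = sets borel"
  using real_distribution.events_eq_borel[OF real_distribution_kernel] .

lemma space_kernel [simp]: "space (\<kappa> x) = UNIV"
  using sets_eq_imp_space_eq[OF sets_kernel] by simp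

text \<open>The preimage of \<open>A\<close> under \<open>X\<close> belongs to the conditioning
  sigma-algebra, so the indicator of \<open>B\<close> may be replaced there by its conditional
  expectation, which the kernel represents almost everywhere.\<close>

lemma rectangle:
  assumes [measurable]: "A \<in> sets borel" "B \<in> sets borel"
  shows "emeasure M {\<omega> \<in> space M. X \<omega> \<in> A \<and> Y \<omega> \<in> B} = (\<integral>\<^sup>+\<omega>. indicator A (X \<omega>) * emeasure (\<kappa> (X \<omega>)) B \<partial>M)"
proof -
  let ?F = "vimage_algebra (space M) X borel"
  interpret F: finite_measure_subalgebra M ?F
    by (rule finite_measure_subalgebra.intro[OF finite_measure_axioms])
       (auto simp: finite_measure_subalgebra_axioms_def subalgebra_def sets_vimage_algebra2)
  let ?A = "X -` A \<inter> space M"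
  have A: "?A \<in> sets ?F" by (auto simp: sets_vimage_algebra2)
  have [measurable]: "(\<lambda>\<omega>. measure (\<kappa> (X \<omega>)) B) \<in> borel_measurable M"
    by (rule measurable_compose[OF X]) measurable
  have le1: "measure (\<kappa> x) B \<le> 1" for x
    using real_distribution_kernel[of x] by (simp add: real_distribution_def prob_space.prob_le_1)
  have int: "integrable M (\<lambda>\<omega>. indicator B (Y \<omega>) :: real)"
    by (rule integrable_const_bound[where B = 1]) (auto simp: indicator_def)
  have "prob {\<omega> \<in> space M. X \<omega> \<in> A \<and> Y \<omega> \<in> B} = (LINT \<omega>:?A|M. indicator B (Y \<omega>))"
  proof -
    have "prob {\<omega> \<in> space M. X \<omega> \<in> A \<and> Y \<omega> \<in> B} = (LINT \<omega>|M. indicator {\<omega> \<in> space M. X \<omega> \<in> A \<and> Y \<omega> \<in> B} \<omega>)"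
      by simp
    also have "\<dots> = (LINT \<omega>:?A|M. indicator B (Y \<omega>))"
      unfolding set_lebesgue_integral_def
      by (rule Bochner_Integration.integral_cong) (auto simp: indicator_def)
    finally show ?thesis .
  qed
  also have "\<dots> = (LINT \<omega>:?A|M. real_cond_exp M ?F (\<lambda>\<omega>. indicator B (Y \<omega>)) \<omega>)"
    using int A by (rule F.real_cond_exp_intA)
  also have "\<dots> = (LINT \<omega>:?A|M. measure (\<kappa> (X \<omega>)) B)"
    unfolding set_lebesgue_integral_def
    by (intro integral_cong_AE) (use regular in \<open>auto simp: is_regular_cond_law_def\<close>)
  also have "\<dots> = (LINT \<omega>|M. indicator A (X \<omega>) * measure (\<kappa> (X \<omega>)) B)"
    unfolding set_lebesgue_integral_def
    by (rule Bochner_Integration.integral_cong) (auto simp: indicator_def)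
  finally have "emeasure M {\<omega> \<in> space M. X \<omega> \<in> A \<and> Y \<omega> \<in> B} = ennreal \<dots>"
    by (simp add: emeasure_eq_measure)
  also have "\<dots> = (\<integral>\<^sup>+\<omega>. ennreal (indicator A (X \<omega>) * measure (\<kappa> (X \<omega>)) B) \<partial>M)"
    by (rule nn_integral_eq_integral[symmetric], rule integrable_const_bound[where B = 1])
       (auto simp: indicator_def le1)
  also have "\<dots> = (\<integral>\<^sup>+\<omega>. indicator A (X \<omega>) * emeasure (\<kappa> (X \<omega>)) B \<partial>M)"
    using real_distribution_kernel
    by (intro nn_integral_cong)
       (auto simp: indicator_def real_distribution_def prob_space_def finite_measure.emeasure_eq_measure)
  finally show ?thesis .
qed

text \<open>The joint law of \<open>X\<close> and \<open>Y\<close> is the law of \<open>X\<close>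
  bound with the kernel: both measures agree on rectangles, which form an intersection-stable
  generator.\<close>

lemma nn_integral_disintegrate:
  assumes h [measurable]: "h \<in> borel_measurable (borel \<Otimes>\<^sub>M borel)"
  shows "(\<integral>\<^sup>+\<omega>. h (X \<omega>, Y \<omega>) \<partial>M) = (\<integral>\<^sup>+\<omega>. \<integral>\<^sup>+y. h (X \<omega>, y) \<partial>\<kappa> (X \<omega>) \<partial>M)"
proof -
  let ?P = "borel \<Otimes>\<^sub>M borel :: (real \<times> real) measure"
  \<comment> \<open>\<open>T x\<close> places the conditional law on the fibre over
    \<open>x\<close>, so that binding yields a measure on the plane rather than only the law of
    \<open>Y\<close>.\<close>
  define T where "T x = distr (\<kappa> x) ?P (Pair x)" for x
  have T [measurable]: "T \<in> borel \<rightarrow>\<^sub>M subprob_algebra ?P"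
    unfolding T_def by (rule measurable_distr2[where M = borel]) auto
  let ?L = "distr M ?P (\<lambda>\<omega>. (X \<omega>, Y \<omega>))" and ?R = "distr M borel X \<bind> T"
  have [simp]: "sets ?R = sets ?P"
    by (rule sets_bind) (use T in \<open>auto simp: T_def\<close>)
  have "?L = ?R"
  proof (rule measure_eqI_generator_eq[OF Int_stable_pair_measure_generator[of borel borel]])
    fix C :: "(real \<times> real) set" assume "C \<in> {A \<times> B |A B. A \<in> sets borel \<and> B \<in> sets borel}"
    then obtain A B where C: "C = A \<times> B" and [measurable]: "A \<in> sets borel" "B \<in> sets borel" by auto
    have T_C: "emeasure (T x) C = indicator A x * emeasure (\<kappa> x) B" for x
    proof -
      have "Pair x -` (A \<times> B) = (if x \<in> A then B else {})" by auto
      then show ?thesis by (simp add: T_def C emeasure_distr indicator_def)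
    qed
    have "emeasure ?R C = (\<integral>\<^sup>+x. emeasure (T x) C \<partial>distr M borel X)"
      by (rule emeasure_bind[where N = ?P]) (auto simp: C)
    also have "\<dots> = (\<integral>\<^sup>+\<omega>. emeasure (T (X \<omega>)) C \<partial>M)"
      by (rule nn_integral_distr) (auto simp: C)
    also have "\<dots> = emeasure ?L C"
      unfolding T_C by (subst rectangle[symmetric])
         (auto simp: emeasure_distr C intro!: arg_cong[where f = "emeasure M"])
    finally show "emeasure ?L C = emeasure ?R C" by simp
  next
    show "range (\<lambda>_. UNIV \<times> UNIV) \<subseteq> {A \<times> B |A B. A \<in> sets borel \<and> B \<in> sets (borel :: real measure)}"
      by (auto intro!: exI[of _ UNIV])
    show "emeasure ?L (UNIV \<times> UNIV) \<noteq> \<infinity>" for i :: nat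
      using pair_measureI[of UNIV borel UNIV borel]
      by (subst emeasure_distr) (auto simp: emeasure_eq_measure)
  qed (auto simp: sets_pair_measure)
  then have "(\<integral>\<^sup>+p. h p \<partial>?L) = (\<integral>\<^sup>+x. \<integral>\<^sup>+p. h p \<partial>T x \<partial>distr M borel X)"
    by (simp add: nn_integral_bind[OF h])
  also have "\<dots> = (\<integral>\<^sup>+\<omega>. \<integral>\<^sup>+p. h p \<partial>T (X \<omega>) \<partial>M)"
    by (rule nn_integral_distr) measurable
  finally show ?thesis by (simp add: nn_integral_distr T_def)
qed

text \<open>On the fibre over \<open>x\<close> the integrand becomes a fixed function on the plane,
  and the integral of a fixed function is measurable in the measure.\<close>

lemma borel_measurable_integral_kernel [measurable]:
  fixes h :: "real \<times> real \<Rightarrow> real"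
  assumes h [measurable]: "h \<in> borel_measurable (borel \<Otimes>\<^sub>M borel)"
  shows "(\<lambda>x. LINT y|\<kappa> x. h (x, y)) \<in> borel_measurable borel"
proof -
  let ?P = "borel \<Otimes>\<^sub>M borel :: (real \<times> real) measure"
  have "(\<lambda>x. distr (\<kappa> x) ?P (Pair x)) \<in> borel \<rightarrow>\<^sub>M subprob_algebra ?P"
    by (rule measurable_distr2[where M = borel]) auto
  from measurable_compose[OF this integral_measurable_subprob_algebra[OF h]]
  show ?thesis by (simp add: integral_distr)
qed

text \<open>A finite double integral forces the inner integrals to be finite almost everywhere;
  there the Bochner and the nonnegative integral agree.\<close>

lemma integral_disintegrate_nonneg:
  fixes h :: "real \<times> real \<Rightarrow> real"
  assumes h [measurable]: "h \<in> borel_measurable (borel \<Otimes>\<^sub>M borel)" and nonneg: "\<And>p. 0 \<le> h p"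
    and int: "integrable M (\<lambda>\<omega>. h (X \<omega>, Y \<omega>))"
  shows "AE \<omega> in M. integrable (\<kappa> (X \<omega>)) (\<lambda>y. h (X \<omega>, y))" (is ?AE)
    and "has_bochner_integral M (\<lambda>\<omega>. LINT y|\<kappa> (X \<omega>). h (X \<omega>, y)) (LINT \<omega>|M. h (X \<omega>, Y \<omega>))"
proof -
  have [measurable]: "(\<lambda>x. \<integral>\<^sup>+y. ennreal (h (x, y)) \<partial>\<kappa> x) \<in> borel_measurable borel"
    by (rule nn_integral_measurable_subprob_algebra2) measurable
  have eq: "(\<integral>\<^sup>+\<omega>. \<integral>\<^sup>+y. ennreal (h (X \<omega>, y)) \<partial>\<kappa> (X \<omega>) \<partial>M) = ennreal (LINT \<omega>|M. h (X \<omega>, Y \<omega>))"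
    using nn_integral_disintegrate[of "\<lambda>p. ennreal (h p)"] nn_integral_eq_integral[OF int] nonneg by simp
  have "AE \<omega> in M. (\<integral>\<^sup>+y. ennreal (h (X \<omega>, y)) \<partial>\<kappa> (X \<omega>)) \<noteq> \<infinity>"
    by (rule nn_integral_PInf_AE) (auto simp: eq)
  then show AE: ?AE
    by eventually_elim (auto simp: nonneg less_top intro!: integrableI_nonneg)
  have m: "(\<lambda>\<omega>. LINT y|\<kappa> (X \<omega>). h (X \<omega>, y)) \<in> borel_measurable M"
    by (rule measurable_compose[OF X borel_measurable_integral_kernel[OF h]])
  show "has_bochner_integral M (\<lambda>\<omega>. LINT y|\<kappa> (X \<omega>). h (X \<omega>, y)) (LINT \<omega>|M. h (X \<omega>, Y \<omega>))"
  proof (rule has_bochner_integral_nn_integral[OF m])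
    show "(\<integral>\<^sup>+\<omega>. ennreal (LINT y|\<kappa> (X \<omega>). h (X \<omega>, y)) \<partial>M) = ennreal (LINT \<omega>|M. h (X \<omega>, Y \<omega>))"
      unfolding eq[symmetric]
      by (rule nn_integral_cong_AE, use AE in eventually_elim)
         (auto simp: nonneg nn_integral_eq_integral)
  qed (auto simp: nonneg intro!: integral_nonneg_AE)
qed

text \<open>Reduces to the nonnegative case through positive and negative parts.\<close>

lemma integral_disintegrate:
  fixes h :: "real \<times> real \<Rightarrow> real"
  assumes h [measurable]: "h \<in> borel_measurable (borel \<Otimes>\<^sub>M borel)"
    and int: "integrable M (\<lambda>\<omega>. h (X \<omega>, Y \<omega>))"
  shows "AE \<omega> in M. integrable (\<kappa> (X \<omega>)) (\<lambda>y. h (X \<omega>, y))" (is ?AE)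
    and "(LINT \<omega>|M. LINT y|\<kappa> (X \<omega>). h (X \<omega>, y)) = (LINT \<omega>|M. h (X \<omega>, Y \<omega>))"
proof -
  let ?p = "\<lambda>p. max 0 (h p)" and ?n = "\<lambda>p. max 0 (- h p)"
  have h_eq: "h p = ?p p - ?n p" for p by simp
  have ints: "integrable M (\<lambda>\<omega>. ?p (X \<omega>, Y \<omega>))" "integrable M (\<lambda>\<omega>. ?n (X \<omega>, Y \<omega>))"
    using int by auto
  note P = integral_disintegrate_nonneg[of ?p, OF _ _ ints(1)]
  note N = integral_disintegrate_nonneg[of ?n, OF _ _ ints(2)]
  have AE_P: "AE \<omega> in M. integrable (\<kappa> (X \<omega>)) (\<lambda>y. ?p (X \<omega>, y))" by (rule P) auto
  have AE_N: "AE \<omega> in M. integrable (\<kappa> (X \<omega>)) (\<lambda>y. ?n (X \<omega>, y))" by (rule N) auto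
  show ?AE
    using AE_P AE_N
  proof eventually_elim
    case (elim \<omega>)
    then show ?case by (subst h_eq) (rule Bochner_Integration.integrable_diff)
  qed
  have hP: "has_bochner_integral M (\<lambda>\<omega>. LINT y|\<kappa> (X \<omega>). ?p (X \<omega>, y)) (LINT \<omega>|M. ?p (X \<omega>, Y \<omega>))"
    by (rule P) auto
  have hN: "has_bochner_integral M (\<lambda>\<omega>. LINT y|\<kappa> (X \<omega>). ?n (X \<omega>, y)) (LINT \<omega>|M. ?n (X \<omega>, Y \<omega>))"
    by (rule N) auto
  have "(LINT \<omega>|M. LINT y|\<kappa> (X \<omega>). h (X \<omega>, y))
      = (LINT \<omega>|M. (LINT y|\<kappa> (X \<omega>). ?p (X \<omega>, y)) - (LINT y|\<kappa> (X \<omega>). ?n (X \<omega>, y)))"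
  \<comment> \<open>The inner integral is split only where both parts are integrable, hence almost
    everywhere, which is why measurability of both sides has to be supplied.\<close>
  proof (rule integral_cong_AE)
    show "(\<lambda>\<omega>. LINT y|\<kappa> (X \<omega>). h (X \<omega>, y)) \<in> borel_measurable M"
      by (rule measurable_compose[OF X borel_measurable_integral_kernel[OF h]])
    show "(\<lambda>\<omega>. (LINT y|\<kappa> (X \<omega>). ?p (X \<omega>, y)) - (LINT y|\<kappa> (X \<omega>). ?n (X \<omega>, y))) \<in> borel_measurable M"
      using hP hN by (intro borel_measurable_diff) (auto simp: has_bochner_integral_iff)
    show "AE \<omega> in M. (LINT y|\<kappa> (X \<omega>). h (X \<omega>, y))
        = (LINT y|\<kappa> (X \<omega>). ?p (X \<omega>, y)) - (LINT y|\<kappa> (X \<omega>). ?n (X \<omega>, y))"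
      using AE_P AE_N
    proof eventually_elim
      case (elim \<omega>)
      then show ?case by (subst h_eq) (rule Bochner_Integration.integral_diff)
    qed
  qed
  also have "\<dots> = (LINT \<omega>|M. ?p (X \<omega>, Y \<omega>)) - (LINT \<omega>|M. ?n (X \<omega>, Y \<omega>))"
    using has_bochner_integral_diff[OF hP hN] by (simp add: has_bochner_integral_iff)
  also have "\<dots> = (LINT \<omega>|M. h (X \<omega>, Y \<omega>))"
    \<comment> \<open>Only the occurrence of \<open>h\<close> outside the positive and negative
      parts is to be decomposed.\<close>
    by (subst (3) h_eq) (rule Bochner_Integration.integral_diff[symmetric, OF ints])
  finally show "(LINT \<omega>|M. LINT y|\<kappa> (X \<omega>). h (X \<omega>, y)) = (LINT \<omega>|M. h (X \<omega>, Y \<omega>))" .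
qed

section \<open>Conditional quantiles and the averaged conditional minimum\<close>

text \<open>The Galois property turns a sublevel set of the quantile into a superlevel set of the
  conditional distribution function at a fixed point, which is measurable in
  \<open>x\<close>.\<close>

lemma borel_measurable_quantile_kernel:
  assumes \<alpha>: "0 < \<alpha>" "\<alpha> < 1"
  shows "(\<lambda>x. quantile (\<kappa> x) \<alpha>) \<in> borel_measurable borel"
proof (rule borel_measurable_iff_le[THEN iffD2], rule allI)
  fix t
  have [measurable]: "(\<lambda>x. cdf (\<kappa> x) t) \<in> borel_measurable borel"
    unfolding cdf_def by measurable
  have "{x \<in> space borel. quantile (\<kappa> x) \<alpha> \<le> t} = {x \<in> space borel. \<alpha> \<le> cdf (\<kappa> x) t}"
    using real_distribution.quantile_le_iff[OF real_distribution_kernel \<alpha>] by auto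
  also have "\<dots> \<in> sets borel" by measurable
  finally show "{x \<in> space borel. quantile (\<kappa> x) \<alpha> \<le> t} \<in> sets borel" .
qed

text \<open>Almost every conditional law puts mass 1 - \<alpha> above its own quantile; averaging
  keeps this constant. Thus the conditioning event has positive probability.\<close>

lemma prob_gt_cond_quantile:
  assumes \<alpha>: "0 < \<alpha>" "\<alpha> < 1" and cont: "AE \<omega> in M. continuous_law (\<kappa> (X \<omega>))"
  shows "prob {\<omega> \<in> space M. quantile (\<kappa> (X \<omega>)) \<alpha> < Y \<omega>} = 1 - \<alpha>"
proof -
  note [measurable] = borel_measurable_quantile_kernel[OF \<alpha>]
  let ?h = "\<lambda>p. indicator {p. quantile (\<kappa> (fst p)) \<alpha> < snd p} p :: real"
  have h [measurable]: "?h \<in> borel_measurable (borel \<Otimes>\<^sub>M borel)" by measurable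
  have int: "integrable M (\<lambda>\<omega>. ?h (X \<omega>, Y \<omega>))"
    by (rule integrable_const_bound[where B = 1]) (auto simp: indicator_def)
  have "prob {\<omega> \<in> space M. quantile (\<kappa> (X \<omega>)) \<alpha> < Y \<omega>}
      = (LINT \<omega>|M. indicator {\<omega> \<in> space M. quantile (\<kappa> (X \<omega>)) \<alpha> < Y \<omega>} \<omega>)" by simp
  also have "\<dots> = (LINT \<omega>|M. ?h (X \<omega>, Y \<omega>))"
    by (rule Bochner_Integration.integral_cong) (auto simp: indicator_def)
  also have "\<dots> = (LINT \<omega>|M. LINT y|\<kappa> (X \<omega>). ?h (X \<omega>, y))"
    by (rule integral_disintegrate(2)[OF h int, symmetric])
  also have "\<dots> = (LINT \<omega>|M. 1 - \<alpha>)"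
  proof (rule integral_cong_AE)
    show "(\<lambda>\<omega>. LINT y|\<kappa> (X \<omega>). ?h (X \<omega>, y)) \<in> borel_measurable M"
      by (rule measurable_compose[OF X borel_measurable_integral_kernel[OF h]])
    show "AE \<omega> in M. (LINT y|\<kappa> (X \<omega>). ?h (X \<omega>, y)) = 1 - \<alpha>"
      using cont
    proof eventually_elim
      case (elim \<omega>)
      have "(LINT y|\<kappa> (X \<omega>). ?h (X \<omega>, y)) = (LINT y|\<kappa> (X \<omega>). indicator {quantile (\<kappa> (X \<omega>)) \<alpha><..} y)"
        by (rule Bochner_Integration.integral_cong) (auto simp: indicator_def)
      then show ?case
        using real_distribution.prob_gt_quantile[OF real_distribution_kernel \<alpha> elim] by simp
    qed
  qed auto
  finally show ?thesis by (simp add: prob_space)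
qed

text \<open>Each conditional minimum is a tail integral at the conditional quantile; disintegration
  reassembles these into one integral of \<open>Y\<close> over the event above the conditional
  quantile.\<close>

lemma integral_min_value_cond_law:
  assumes \<alpha>: "0 < \<alpha>" "\<alpha> < 1" and int: "integrable M Y"
    and cont: "AE \<omega> in M. continuous_law (\<kappa> (X \<omega>))"
  shows "(LINT \<omega>|M. min_value (\<lambda>\<theta>. LINT y|\<kappa> (X \<omega>). quantile_contrast \<alpha> y \<theta>))
    = (LINT \<omega>:{\<omega> \<in> space M. quantile (\<kappa> (X \<omega>)) \<alpha> < Y \<omega>}|M. Y \<omega>) - (1 - \<alpha>) * (LINT \<omega>|M. Y \<omega>)"
proof -
  note [measurable] = borel_measurable_quantile_kernel[OF \<alpha>]
  let ?Q = "{\<omega> \<in> space M. quantile (\<kappa> (X \<omega>)) \<alpha> < Y \<omega>}"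
  let ?g = "\<lambda>p. quantile_contrast \<alpha> (snd p) (quantile (\<kappa> (fst p)) \<alpha>)"
  let ?h = "\<lambda>p. snd p * (indicator {p. quantile (\<kappa> (fst p)) \<alpha> < snd p} p - (1 - \<alpha>)) :: real"
  have g: "?g \<in> borel_measurable (borel \<Otimes>\<^sub>M borel)" by measurable
  have h [measurable]: "?h \<in> borel_measurable (borel \<Otimes>\<^sub>M borel)" by measurable
  have hXY: "?h (X \<omega>, Y \<omega>) = indicator ?Q \<omega> *\<^sub>R Y \<omega> - (1 - \<alpha>) * Y \<omega>" if "\<omega> \<in> space M" for \<omega>
    using that by (auto simp: indicator_def algebra_simps)
  have intQ: "integrable M (\<lambda>\<omega>. indicator ?Q \<omega> *\<^sub>R Y \<omega>)"
    by (rule integrable_mult_indicator[OF _ int]) measurable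
  have inth: "integrable M (\<lambda>\<omega>. ?h (X \<omega>, Y \<omega>))"
    using intQ int by (subst Bochner_Integration.integrable_cong[OF refl hXY]) auto
  \<comment> \<open>Disintegrating the second coordinate turns the finite mean of \<open>Y\<close>
    into finite conditional means.\<close>
  have intY: "AE \<omega> in M. integrable (\<kappa> (X \<omega>)) (\<lambda>y. y)"
    using integral_disintegrate(1)[of snd] int by simp
  \<comment> \<open>The minimum is replaced at every \<omega>, before any almost-everywhere fact
    enters; the new integrand is measurable, as the next step requires.\<close>
  have "(LINT \<omega>|M. min_value (\<lambda>\<theta>. LINT y|\<kappa> (X \<omega>). quantile_contrast \<alpha> y \<theta>))
      = (LINT \<omega>|M. LINT y|\<kappa> (X \<omega>). ?g (X \<omega>, y))"
    using real_distribution.min_value_contrast[OF real_distribution_kernel \<alpha>] by simp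
  also have "\<dots> = (LINT \<omega>|M. LINT y|\<kappa> (X \<omega>). ?h (X \<omega>, y))"
  proof (rule integral_cong_AE)
    show "(\<lambda>\<omega>. LINT y|\<kappa> (X \<omega>). ?g (X \<omega>, y)) \<in> borel_measurable M"
      by (rule measurable_compose[OF X borel_measurable_integral_kernel[OF g]])
    show "(\<lambda>\<omega>. LINT y|\<kappa> (X \<omega>). ?h (X \<omega>, y)) \<in> borel_measurable M"
      by (rule measurable_compose[OF X borel_measurable_integral_kernel[OF h]])
    show "AE \<omega> in M. (LINT y|\<kappa> (X \<omega>). ?g (X \<omega>, y)) = (LINT y|\<kappa> (X \<omega>). ?h (X \<omega>, y))"
      using cont intY
    proof eventually_elim
      case (elim \<omega>)
      have "(LINT y|\<kappa> (X \<omega>). ?h (X \<omega>, y))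
          = (LINT y|\<kappa> (X \<omega>). y * (indicator {quantile (\<kappa> (X \<omega>)) \<alpha><..} y - (1 - \<alpha>)))"
        by (rule Bochner_Integration.integral_cong) (auto simp: indicator_def)
      then show ?case
        using real_distribution.integral_contrast_quantile[OF real_distribution_kernel \<alpha> elim] by simp
    qed
  qed
  also have "\<dots> = (LINT \<omega>|M. ?h (X \<omega>, Y \<omega>))"
    by (rule integral_disintegrate(2)[OF h inth])
  also have "\<dots> = (LINT \<omega>|M. indicator ?Q \<omega> *\<^sub>R Y \<omega> - (1 - \<alpha>) * Y \<omega>)"
    by (rule Bochner_Integration.integral_cong[OF refl hXY])
  also have "\<dots> = (LINT \<omega>:?Q|M. Y \<omega>) - (1 - \<alpha>) * (LINT \<omega>|M. Y \<omega>)"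
    unfolding set_lebesgue_integral_def using intQ int by (subst Bochner_Integration.integral_diff) auto
  finally show ?thesis .
qed

end

section \<open>The law of \<open>Y\<close> and the index formula\<close>

lemma (in prob_space) prob_gt_quantile_distr:
  assumes [measurable]: "Y \<in> borel_measurable M"
    and \<alpha>: "0 < \<alpha>" "\<alpha> < 1" and cont: "continuous_law (distr M borel Y)"
  shows "prob {\<omega> \<in> space M. quantile (distr M borel Y) \<alpha> < Y \<omega>} = 1 - \<alpha>"
proof -
  interpret D: real_distribution "distr M borel Y" by (rule real_distribution_distr) measurable
  have "{\<omega> \<in> space M. quantile (distr M borel Y) \<alpha> < Y \<omega>} = Y -` {quantile (distr M borel Y) \<alpha><..} \<inter> space M"
    by auto
  then show ?thesis using D.prob_gt_quantile[OF \<alpha> cont] by (simp add: measure_distr)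
qed

lemma (in prob_space) min_value_contrast_distr:
  assumes \<alpha>: "0 < \<alpha>" "\<alpha> < 1" and int: "integrable M Y" and cont: "continuous_law (distr M borel Y)"
  shows "min_value (\<lambda>\<theta>. LINT \<omega>|M. quantile_contrast \<alpha> (Y \<omega>) \<theta>)
      = (LINT \<omega>:{\<omega> \<in> space M. quantile (distr M borel Y) \<alpha> < Y \<omega>}|M. Y \<omega>) - (1 - \<alpha>) * (LINT \<omega>|M. Y \<omega>)"
    (is "?m = ?r")
    and "0 < min_value (\<lambda>\<theta>. LINT \<omega>|M. quantile_contrast \<alpha> (Y \<omega>) \<theta>)"
proof -
  have Y [measurable]: "Y \<in> borel_measurable M" using int by auto
  interpret D: real_distribution "distr M borel Y" by (rule real_distribution_distr) measurable
  let ?q = "quantile (distr M borel Y) \<alpha>"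
  let ?Q = "{\<omega> \<in> space M. ?q < Y \<omega>}"
  have intD: "integrable (distr M borel Y) (\<lambda>y. y)"
    using int by (simp add: integrable_distr_eq)
  have psi: "(LINT \<omega>|M. quantile_contrast \<alpha> (Y \<omega>) \<theta>) = (LINT y|distr M borel Y. quantile_contrast \<alpha> y \<theta>)" for \<theta>
    by (rule integral_distr[symmetric]) measurable
  have intQ: "integrable M (\<lambda>\<omega>. indicator ?Q \<omega> *\<^sub>R Y \<omega>)"
    by (rule integrable_mult_indicator[OF _ int]) measurable
  have m: "?m = (LINT y|distr M borel Y. quantile_contrast \<alpha> y ?q)"
    unfolding psi by (rule D.min_value_contrast[OF \<alpha>])
  also have "\<dots> = (LINT y|distr M borel Y. y * (indicator {?q<..} y - (1 - \<alpha>)))"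
    by (rule D.integral_contrast_quantile[OF \<alpha> cont intD])
  also have "\<dots> = (LINT \<omega>|M. Y \<omega> * (indicator {?q<..} (Y \<omega>) - (1 - \<alpha>)))"
    by (rule integral_distr) measurable
  also have "\<dots> = (LINT \<omega>|M. indicator ?Q \<omega> *\<^sub>R Y \<omega> - (1 - \<alpha>) * Y \<omega>)"
    by (rule Bochner_Integration.integral_cong) (auto simp: indicator_def algebra_simps)
  also have "\<dots> = ?r"
    unfolding set_lebesgue_integral_def using intQ int by (subst Bochner_Integration.integral_diff) auto
  finally show "?m = ?r" .
  show "0 < ?m"
    unfolding m by (rule D.integral_contrast_pos[OF \<alpha> cont intD])
qed

theorem proposition3p1:
  fixes M :: "'a measure" and X :: "'a \<Rightarrow> real ^ 'k" and f :: "real ^ 'k \<Rightarrow> real"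
    and Y :: "'a \<Rightarrow> real" and \<alpha> :: real and i :: 'k
  assumes "prob_space M"
    and "X \<in> borel_measurable M"
    and "prob_space.indep_vars M (\<lambda>_. borel) (\<lambda>j \<omega>. X \<omega> $ j) UNIV"
    and "f \<in> borel_measurable borel"
    and "Y = (\<lambda>\<omega>. f (X \<omega>))"
    and "continuous_law (distr M borel Y)"
    and "AE \<omega> in M. continuous_law (cond_law M (\<lambda>\<omega>. X \<omega> $ i) Y (X \<omega> $ i))"
    and "integrable M Y"
    and "0 < \<alpha>" and "\<alpha> < 1"
  shows "quantile_index M (\<lambda>\<omega>. X \<omega> $ i) Y \<alpha> =
    1 - (expectation_given_event M Y
           {\<omega> \<in> space M. cond_quantile M (\<lambda>\<omega>. X \<omega> $ i) Y \<alpha> \<omega> < Y \<omega>}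
          - (LINT \<omega>|M. Y \<omega>))
        / (CTE M Y \<alpha> - (LINT \<omega>|M. Y \<omega>))"
proof -
  note cont = assms(6) and cond_cont = assms(7) and int = assms(8) and \<alpha> = assms(9,10)
  interpret prob_space M by fact
  have Xi: "(\<lambda>\<omega>. X \<omega> $ i) \<in> borel_measurable M"
    using assms(3) by (auto simp: indep_vars_def)
  \<comment> \<open>Independence of the inputs provides the freezing kernel, a witness that the
    choice in \<open>cond_law\<close> has something to choose.\<close>
  have "is_regular_cond_law M (\<lambda>\<omega>. X \<omega> $ i) Y (cond_law M (\<lambda>\<omega>. X \<omega> $ i) Y)"
    unfolding assms(5) by (rule is_regular_cond_law_cond_law) (rule is_regular_cond_law_freeze[OF assms(1,3,4)])
  then interpret K: cond_law_kernel M "\<lambda>\<omega>. X \<omega> $ i" Y "cond_law M (\<lambda>\<omega>. X \<omega> $ i) Y"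
    by unfold_locales (use Xi int in auto)
  let ?m = "min_value (\<lambda>\<theta>. LINT \<omega>|M. quantile_contrast \<alpha> (Y \<omega>) \<theta>)"
  let ?mc = "LINT \<omega>|M. min_value (\<lambda>\<theta>. LINT y|cond_law M (\<lambda>\<omega>. X \<omega> $ i) Y (X \<omega> $ i). quantile_contrast \<alpha> y \<theta>)"
  let ?Q = "{\<omega> \<in> space M. cond_quantile M (\<lambda>\<omega>. X \<omega> $ i) Y \<alpha> \<omega> < Y \<omega>}"
  have Y: "Y \<in> borel_measurable M" using int by auto
  \<comment> \<open>The tail event has probability 1 - \<alpha> > 0, so multiplying the expectation
    given that event by this factor recovers the tail integral. The conditional minimum below
    carries the same factor, which cancels in the quotient.\<close>
  have "?m = (1 - \<alpha>) * (CTE M Y \<alpha> - (LINT \<omega>|M. Y \<omega>))"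
    unfolding min_value_contrast_distr(1)[OF \<alpha> int cont] CTE_def expectation_given_event_def
      prob_gt_quantile_distr[OF Y \<alpha> cont]
    using \<alpha> by (simp add: right_diff_distrib)
  moreover have "?mc = (1 - \<alpha>) * (expectation_given_event M Y ?Q - (LINT \<omega>|M. Y \<omega>))"
    unfolding K.integral_min_value_cond_law[OF \<alpha> int cond_cont] cond_quantile_def
      expectation_given_event_def K.prob_gt_cond_quantile[OF \<alpha> cond_cont]
    using \<alpha> by (simp add: right_diff_distrib)
  moreover have "0 < ?m"
    by (rule min_value_contrast_distr(2)[OF \<alpha> int cont])
  \<comment> \<open>Positivity of \<open>?m\<close> matters: with division by 0 defined as 0, the
    two sides would be 0 and 1 at \<open>?m = 0\<close>.\<close>
  moreover have "quantile_index M (\<lambda>\<omega>. X \<omega> $ i) Y \<alpha> = 1 - ?mc / ?m"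
    using \<open>0 < ?m\<close> unfolding quantile_index_def by (simp add: diff_divide_distrib)
  ultimately show ?thesis using \<alpha> by simp
qed

end
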